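(* Let $k\ge1$ be an integer and $m=2k+1$. Let $\tilde T\in\mathbb{C}^{m-1}\otimes\mathbb{C}^{k+1}\otimes\mathbb{C}^{k+1}$ be the tensor represented by the $(k+1)\times(k+1)$ matrix $$\begin{pmatrix}x_0&0&0&\cdots&0&0\\ x_1&x_0&0&\cdots&0&0\\ x_2&0&x_0&&0&0\\ \vdots&&&\ddots&&\\ x_{k-1}&0&0&\cdots&x_0&0\\ x_k&x_{k+1}&x_{k+2}&\cdots&x_{2k-1}&x_0\end{pmatrix}$$ (diagonal entries $x_0$; first column $x_0,x_1,\dots,x_k$; last row $x_k,x_{k+1},\dots,x_{2k-1},x_0$; all other entries zero). Let $T_{biggap,m}\in\mathbb{C}^m\otimes\mathbb{C}^m\otimes\mathbb{C}^m$ be the tensor such that the $m\times m$ matrix $T_{biggap,m}(A^* )$ has the matrix of $\tilde T$ in its lower left $(k+1)\times(k+1)$ corner, $x_{2k}$ in all entries along the diagonal, and zeros elsewhere. Then $$m\le\underline{\mathbf R}(T_{biggap,m})\le m+1\quad\text{and}\quad\mathbf R(T_{biggap,m})=\tfrac52(m-1).$$ In particular the ratio of rank to border rank tends to $\frac52$ as $m\to\infty$.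
   Context: All vector spaces are over $\mathbb{C}$. A matrix of linear forms $\sum_i x_iM_i$ in independent variables $x_i$ represents the tensor $\sum_i a_i\otimes M_i$, where $\{a_i\}$ is a basis of the first factor $A$ and the $M_i$ are viewed as elements of the tensor product of the last two factors. (The diagonal of the $m\times m$ matrix meets the lower left $(k+1)\times(k+1)$ corner only in the upper right entry of that corner, where the matrix of $\tilde T$ has a $0$.) $\mathbf R(T)$ is the tensor rank, the least number of tensors $u\otimes v\otimes w$ summing to $T$; $\underline{\mathbf R}(T)$ is the border rank, the least $r$ such that $T$ is a limit of tensors of rank $r$. *)

theory Defs
  imports Complex_Main
begin

text \<open>
  The dimensions of the tensors vary with a natural number inside the statement, so an element of
  $\mathbb{C}^a \otimes \mathbb{C}^b \otimes \mathbb{C}^c$ is given by its coordinates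
  \<open>T i j l\<close>, \<open>i < a\<close>, \<open>j < b\<close>, \<open>l < c\<close>, in the standard bases (indexed from 0). The dimensions
  are passed explicitly; values of \<open>T\<close> outside these ranges are irrelevant. The same convention is
  used for vectors and matrices.
\<close>

type_synonym tensor3 = "nat \<Rightarrow> nat \<Rightarrow> nat \<Rightarrow> complex"

definition simple_tensor ::
  "(nat \<Rightarrow> complex) \<Rightarrow> (nat \<Rightarrow> complex) \<Rightarrow> (nat \<Rightarrow> complex) \<Rightarrow> tensor3" where
  "simple_tensor u v w = (\<lambda>i j l. u i * v j * w l)"

definition tensor_rank :: "nat \<Rightarrow> nat \<Rightarrow> nat \<Rightarrow> tensor3 \<Rightarrow> nat" where
  "tensor_rank a b c T =
     (LEAST r. \<exists>u v w :: nat \<Rightarrow> nat \<Rightarrow> complex.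
        \<forall>i<a. \<forall>j<b. \<forall>l<c. T i j l = (\<Sum>s<r. simple_tensor (u s) (v s) (w s) i j l))"

definition border_rank :: "nat \<Rightarrow> nat \<Rightarrow> nat \<Rightarrow> tensor3 \<Rightarrow> nat" where
  "border_rank a b c T =
     (LEAST r. \<exists>S :: nat \<Rightarrow> tensor3.
        (\<forall>n. tensor_rank a b c (S n) = r) \<and>
        (\<forall>i<a. \<forall>j<b. \<forall>l<c. (\<lambda>n. S n i j l) \<longlonglongrightarrow> T i j l))"

text \<open>
  A matrix of linear forms $\sum_i x_i M_i$ is a function of \<open>x\<close>. Its coefficient matrix $M_i$ is
  its value at the \<open>i\<close>-th unit vector, so that $\sum_i a_i \otimes M_i$ has coordinates
  $(M_i)_{jl}$.
\<close>

definition tensor_of_matrix :: "((nat \<Rightarrow> complex) \<Rightarrow> nat \<Rightarrow> nat \<Rightarrow> complex) \<Rightarrow> tensor3" where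
  "tensor_of_matrix M = (\<lambda>i j l. M (\<lambda>n. if n = i then 1 else 0) j l)"

text \<open>
  The \<open>(k+1) \<times> (k+1)\<close> matrix of $\tilde T$ in \<open>x 0, \<dots>, x (2*k-1)\<close>; row \<open>j\<close>, column \<open>l\<close>, both from 0.
\<close>

definition Ttilde_matrix :: "nat \<Rightarrow> (nat \<Rightarrow> complex) \<Rightarrow> nat \<Rightarrow> nat \<Rightarrow> complex" where
  "Ttilde_matrix k x j l =
     (if j = l then x 0
      else if l = 0 then x j
      else if j = k then x (k + l)
      else 0)"

text \<open>
  The lower left corner consists of the rows \<open>k, \<dots>, 2*k\<close> and the columns \<open>0, \<dots>, k\<close>. It meets the
  diagonal only in the entry \<open>(k, k)\<close>, where the matrix of $\tilde T$ vanishes (for \<open>k \<ge> 1\<close>) and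
  the diagonal entry is the one that counts.
\<close>

definition biggap_matrix :: "nat \<Rightarrow> (nat \<Rightarrow> complex) \<Rightarrow> nat \<Rightarrow> nat \<Rightarrow> complex" where
  "biggap_matrix k x j l =
     (if j = l then x (2 * k)
      else if k \<le> j \<and> l \<le> k then Ttilde_matrix k x (j - k) l
      else 0)"

text \<open>The tensor $T_{biggap,m}$ for \<open>m = 2 * k + 1\<close>.\<close>

definition T_biggap :: "nat \<Rightarrow> tensor3" where
  "T_biggap k = tensor_of_matrix (biggap_matrix k)"

lemma T_biggap_represents:
  assumes "k \<ge> 1" "j < 2 * k + 1" "l < 2 * k + 1"
  shows "(\<Sum>i<2 * k + 1. x i * T_biggap k i j l) = biggap_matrix k x j l"
proof -
  have eq: "(\<Sum>i<n. x i * (if p = i then 1 else 0)) = x p" if "p < n" for p n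
    using that by (subst sum.cong[OF refl, where h = "\<lambda>i. if p = i then x i else 0"]) auto
  have eq0: "(\<Sum>i<n. x i * (if i = 0 then 1 else 0)) = x 0" if "0 < n" for n
    using that by (subst sum.cong[OF refl, where h = "\<lambda>i. if 0 = i then x i else 0"]) auto
  show ?thesis
    using assms
    by (auto simp: T_biggap_def tensor_of_matrix_def biggap_matrix_def Ttilde_matrix_def eq eq0)
qed

end

theory Submission
  imports Defs
begin

text \<open>
  The lower bound \<open>5 * k \<le> rank\<close> is the substitution method applied four times. Eliminating the \<open>k\<close>
  rows above the corner block and the \<open>k\<close> columns to its right changes only the slice of \<open>x (2 * k)\<close>,
  so the corner block survives; eliminating the slices of \<open>x 1, \<dots>, x (2 * k - 1)\<close> from it leaves a
  lower triangular \<open>(k + 1) \<times> (k + 1)\<close> matrix with unit diagonal. For the upper bound, the indices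
  \<open>0, k, 2 * k\<close> carry the multiplication of $\mathbb{C}[t]/(t^3)$, of rank 5, and each of the pairs
  \<open>(p, k + p)\<close> with \<open>0 < p < k\<close> contributes five further entries.

  The border rank is at least \<open>m\<close> because the slice of \<open>x (2 * k)\<close> is the identity. It is at most
  \<open>m + 1\<close> because the tensor is a degeneration, under a one-parameter group of diagonal matrices, of
  an explicit sum of \<open>2 * k + 2\<close> simple tensors.
\<close>

text \<open>The four indicators are the main diagonal, the diagonal of the corner block, its first
  column and its last row. They never overlap; the entry \<open>x k\<close>, where column and row
  meet, is counted with the column.\<close>

lemma T_biggap_eq:
  assumes "k \<ge> 1" "i \<le> 2 * k" "j \<le> 2 * k" "l \<le> 2 * k"
  shows "T_biggap k i j l = of_bool (i = 2 * k \<and> j = l) + of_bool (i = 0 \<and> j = k + l)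
    + of_bool (0 < i \<and> i \<le> k \<and> j = k + i \<and> l = 0) + of_bool (k < i \<and> i < 2 * k \<and> j = 2 * k \<and> i = k + l)"
  using assms by (auto simp: T_biggap_def tensor_of_matrix_def biggap_matrix_def Ttilde_matrix_def)

section \<open>Decompositions of given length, rank and border rank\<close>

text \<open>This is the condition minimised in \<open>tensor_rank\<close>, isolated so that
  decompositions can be combined without reference to minimality.\<close>

definition rank_at_most :: "nat \<Rightarrow> nat \<Rightarrow> nat \<Rightarrow> nat \<Rightarrow> tensor3 \<Rightarrow> bool" where
  "rank_at_most a b c r T \<longleftrightarrow> (\<exists>u v w :: nat \<Rightarrow> nat \<Rightarrow> complex.
     \<forall>i<a. \<forall>j<b. \<forall>l<c. T i j l = (\<Sum>s<r. simple_tensor (u s) (v s) (w s) i j l))"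

lemma rank_at_most_cong:
  assumes "rank_at_most a b c r S" "\<And>i j l. i < a \<Longrightarrow> j < b \<Longrightarrow> l < c \<Longrightarrow> T i j l = S i j l"
  shows "rank_at_most a b c r T"
  using assms unfolding rank_at_most_def by force

lemma rank_at_most_zero: "rank_at_most a b c 0 (\<lambda>i j l. 0)"
  by (simp add: rank_at_most_def)

lemma rank_at_most_simple: "rank_at_most a b c 1 (simple_tensor u v w)"
  unfolding rank_at_most_def
  by (rule exI[of _ "\<lambda>_. u"], rule exI[of _ "\<lambda>_. v"], rule exI[of _ "\<lambda>_. w"]) simp

lemma rank_at_most_add:
  assumes "rank_at_most a b c r S" "rank_at_most a b c q T"
  shows "rank_at_most a b c (r + q) (\<lambda>i j l. S i j l + T i j l)"
proof -
  obtain u v w where S: "\<forall>i<a. \<forall>j<b. \<forall>l<c. S i j l = (\<Sum>s<r. simple_tensor (u s) (v s) (w s) i j l)"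
    using assms(1) unfolding rank_at_most_def by blast
  obtain u' v' w' where T: "\<forall>i<a. \<forall>j<b. \<forall>l<c. T i j l = (\<Sum>s<q. simple_tensor (u' s) (v' s) (w' s) i j l)"
    using assms(2) unfolding rank_at_most_def by blast
  define glue where "glue f g s = (if s < r then f s else g (s - r))" for f g :: "nat \<Rightarrow> nat \<Rightarrow> complex" and s
  have split: "(\<Sum>s<r + q. f s) = (\<Sum>s<r. f s) + (\<Sum>s<q. f (r + s))" for f :: "nat \<Rightarrow> complex"
    by (induct q) (auto simp: add.assoc)
  show ?thesis
    unfolding rank_at_most_def
    by (rule exI[of _ "glue u u'"], rule exI[of _ "glue v v'"], rule exI[of _ "glue w w'"])
      (simp add: split glue_def S T)
qed

lemma rank_at_most_sum:
  assumes "finite P" "\<And>p. p \<in> P \<Longrightarrow> rank_at_most a b c q (S p)"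
  shows "rank_at_most a b c (card P * q) (\<lambda>i j l. \<Sum>p\<in>P. S p i j l)"
  using assms
proof (induction P rule: finite_induct)
  case empty
  then show ?case by (simp add: rank_at_most_zero)
next
  case (insert x F)
  then show ?case
    using rank_at_most_add[of a b c q "S x" "card F * q" "\<lambda>i j l. \<Sum>p\<in>F. S p i j l"] by simp
qed

text \<open>The fibres of \<open>T\<close> along the third index give \<open>a * b\<close> simple
  tensors. Hence the minimum in \<open>tensor_rank\<close> is attained.\<close>

lemma rank_at_most_exists: "\<exists>r. rank_at_most a b c r T"
proof -
  have eq: "(\<Sum>p<a. \<Sum>q<b. simple_tensor (\<lambda>i. of_bool (i = p)) (\<lambda>j. of_bool (j = q)) (T p q) i j l) = T i j l"
    if "i < a" "j < b" for i j l
  proof -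
    have "(\<Sum>q<b. simple_tensor (\<lambda>i. of_bool (i = p)) (\<lambda>j. of_bool (j = q)) (T p q) i j l)
        = (if p = i then T p j l else 0)" for p
    proof -
      have "(\<Sum>q<b. simple_tensor (\<lambda>i. of_bool (i = p)) (\<lambda>j. of_bool (j = q)) (T p q) i j l)
        = (\<Sum>q<b. if q = j then of_bool (i = p) * T p q l else 0)"
        by (intro sum.cong) (auto simp: simple_tensor_def)
      then show ?thesis using that by auto
    qed
    then show ?thesis using that by simp
  qed
  have "rank_at_most a b c (card {..<a} * (card {..<b} * 1))
    (\<lambda>i j l. \<Sum>p<a. \<Sum>q<b. simple_tensor (\<lambda>i. of_bool (i = p)) (\<lambda>j. of_bool (j = q)) (T p q) i j l)"
    by (intro rank_at_most_sum rank_at_most_simple) auto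
  then have "rank_at_most a b c (card {..<a} * (card {..<b} * 1)) T"
    by (rule rank_at_most_cong) (simp add: eq)
  then show ?thesis by blast
qed

lemma tensor_rank_le:
  assumes "rank_at_most a b c r T"
  shows "tensor_rank a b c T \<le> r"
  using assms unfolding tensor_rank_def rank_at_most_def by (rule Least_le)

lemma rank_at_most_tensor_rank: "rank_at_most a b c (tensor_rank a b c T) T"
  using rank_at_most_exists[of a b c T] LeastI_ex[of "\<lambda>r. rank_at_most a b c r T"]
  unfolding tensor_rank_def rank_at_most_def by blast

text \<open>\<open>border_rank\<close> asks for a sequence of constant rank, while only an upper
  bound on the ranks is given. Finitely many ranks occur, so one occurs infinitely often, and a
  subsequence of that rank has the same limit.\<close>

lemma border_rank_le:
  assumes rank: "\<And>n. rank_at_most a b c r (S n)"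
    and lim: "\<And>i j l. i < a \<Longrightarrow> j < b \<Longrightarrow> l < c \<Longrightarrow> (\<lambda>n. S n i j l) \<longlonglongrightarrow> T i j l"
  shows "border_rank a b c T \<le> r"
proof -
  let ?f = "\<lambda>n. tensor_rank a b c (S n)"
  have "finite (range ?f)"
    by (rule finite_subset[of _ "{..r}"]) (auto intro: tensor_rank_le rank)
  then obtain n0 where inf: "infinite {n. ?f n = ?f n0}"
    using pigeonhole_infinite[of UNIV ?f] by auto
  then have "\<exists>n'\<ge>n. ?f n' = ?f n0" for n
    unfolding finite_nat_set_iff_bounded_le by (auto simp: not_le intro: less_imp_le)
  then obtain e where e: "\<And>n. n \<le> e n" "\<And>n. ?f (e n) = ?f n0" by metis
  have "filterlim e at_top sequentially"
    by (rule filterlim_at_top_mono[OF filterlim_ident]) (use e(1) in auto)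
  have "border_rank a b c T \<le> ?f n0"
    unfolding border_rank_def
  proof (rule Least_le, rule exI[of _ "S \<circ> e"], intro conjI allI impI)
    show "tensor_rank a b c ((S \<circ> e) n) = ?f n0" for n
      using e by simp
    show "(\<lambda>n. (S \<circ> e) n i j l) \<longlonglongrightarrow> T i j l" if "i < a" "j < b" "l < c" for i j l
      using filterlim_compose[OF lim[OF that] \<open>filterlim e at_top sequentially\<close>] by (simp add: o_def)
  qed
  also have "\<dots> \<le> r" by (rule tensor_rank_le[OF rank])
  finally show ?thesis .
qed

text \<open>The constant sequence \<open>T\<close> shows that some rank is admissible, so the least
  one is attained.\<close>

lemma border_rank_sequence:
  obtains S where "\<And>n. rank_at_most a b c (border_rank a b c T) (S n)"
    and "\<And>i j l. i < a \<Longrightarrow> j < b \<Longrightarrow> l < c \<Longrightarrow> (\<lambda>n. S n i j l) \<longlonglongrightarrow> T i j l"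
proof -
  let ?P = "\<lambda>r. \<exists>S :: nat \<Rightarrow> tensor3. (\<forall>n. tensor_rank a b c (S n) = r) \<and>
        (\<forall>i<a. \<forall>j<b. \<forall>l<c. (\<lambda>n. S n i j l) \<longlonglongrightarrow> T i j l)"
  have "?P (tensor_rank a b c T)"
    by (rule exI[of _ "\<lambda>_. T"]) simp
  then have "?P (border_rank a b c T)"
    unfolding border_rank_def by (rule LeastI)
  then show ?thesis
    using that by (metis rank_at_most_tensor_rank)
qed

section \<open>Linear algebra of the substitution method\<close>

text \<open>Row rank equals column rank: independent rows have an invertible square submatrix on
  some columns \<open>S'\<close>, so any prescribed values on \<open>S'\<close> are reached by a
  combination of the rows. The columns are chosen one per row, by elimination.\<close>

lemma independent_selection:
  fixes u :: "'i \<Rightarrow> 's \<Rightarrow> 'a :: field"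
  assumes "finite J" "finite S"
    and "\<And>c. (\<And>s. s \<in> S \<Longrightarrow> (\<Sum>j\<in>J. c j * u j s) = 0) \<Longrightarrow> (\<And>j. j \<in> J \<Longrightarrow> c j = 0)"
  shows "\<exists>S'\<subseteq>S. card S' = card J \<and> (\<forall>t. \<exists>c. \<forall>s\<in>S'. t s = (\<Sum>j\<in>J. c j * u j s))"
  using assms(1,3)
proof (induction J rule: finite_induct)
  case empty
  then show ?case by (intro exI[of _ "{}"]) auto
next
  case (insert a J)
  have upd: "(\<Sum>j\<in>insert a J. (if j = a then x else c j) * u j s) = x * u a s + (\<Sum>j\<in>J. c j * u j s)" for x c s
  proof -
    have "(\<Sum>j\<in>J. (if j = a then x else c j) * u j s) = (\<Sum>j\<in>J. c j * u j s)"
      using insert.hyps by (intro sum.cong) auto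
    then show ?thesis using insert.hyps by simp
  qed
  have "\<exists>S'\<subseteq>S. card S' = card J \<and> (\<forall>t. \<exists>c. \<forall>s\<in>S'. t s = (\<Sum>j\<in>J. c j * u j s))"
  proof (rule insert.IH)
    fix c j assume c: "\<And>s. s \<in> S \<Longrightarrow> (\<Sum>j\<in>J. c j * u j s) = 0" and j: "j \<in> J"
    have "(if j = a then 0 else c j) = 0"
      by (rule insert.prems) (use c j in \<open>auto simp: upd\<close>)
    then show "c j = 0" using j insert.hyps by (auto split: if_splits)
  qed
  then obtain S' where S': "S' \<subseteq> S" "card S' = card J"
    and sol: "\<And>t. \<exists>c. \<forall>s\<in>S'. t s = (\<Sum>j\<in>J. c j * u j s)" by blast
  obtain d where d: "\<And>s. s \<in> S' \<Longrightarrow> u a s = (\<Sum>j\<in>J. d j * u j s)"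
    using sol[of "u a"] by blast
  \<comment> \<open>\<open>D\<close> is the new row reduced to vanish on \<open>S'\<close>.
    Independence makes it nonzero at some \<open>s1\<close>, which becomes the new column.\<close>
  define D where "D s = u a s - (\<Sum>j\<in>J. d j * u j s)" for s
  obtain s1 where s1: "s1 \<in> S" "D s1 \<noteq> 0"
  proof (rule ccontr)
    assume "\<not> thesis"
    then have "D s = 0" if "s \<in> S" for s using that \<open>\<And>s1. s1 \<in> S \<Longrightarrow> D s1 \<noteq> 0 \<Longrightarrow> thesis\<close> by blast
    then have "(if a = a then 1 else - d a) = (0::'a)"
      by (intro insert.prems[of "\<lambda>j. if j = a then 1 else - d j"]) (auto simp: upd D_def sum_negf)
    then show False by simp
  qed
  have s1': "s1 \<notin> S'" using s1 d by (auto simp: D_def)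
  show ?case
  proof (intro exI[of _ "insert s1 S'"] conjI allI)
    show "insert s1 S' \<subseteq> S" using S' s1 by simp
    show "card (insert s1 S') = card (insert a J)"
      using s1' S' insert.hyps finite_subset[OF S'(1) assms(2)] by simp
    fix t
    obtain c where c: "\<And>s. s \<in> S' \<Longrightarrow> t s = (\<Sum>j\<in>J. c j * u j s)" using sol[of t] by blast
    \<comment> \<open>Adding \<open>x * D\<close> corrects the value at \<open>s1\<close> and leaves
      the values on \<open>S'\<close> alone.\<close>
    define x where "x = (t s1 - (\<Sum>j\<in>J. c j * u j s1)) / D s1"
    have eq: "(\<Sum>j\<in>insert a J. (if j = a then x else c j - x * d j) * u j s)
        = (\<Sum>j\<in>J. c j * u j s) + x * D s" for s
      unfolding upd D_def by (simp add: algebra_simps sum_subtractf sum_distrib_left)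
    show "\<exists>c. \<forall>s\<in>insert s1 S'. t s = (\<Sum>j\<in>insert a J. c j * u j s)"
    proof (rule exI, rule ballI)
      fix s assume "s \<in> insert s1 S'"
      then show "t s = (\<Sum>j\<in>insert a J. (if j = a then x else c j - x * d j) * u j s)"
        unfolding eq using c d s1 s1' by (cases "s = s1") (auto simp: x_def, simp add: D_def)
    qed
  qed
qed

lemma sum_linear_swap:
  fixes b :: "'i \<Rightarrow> 's \<Rightarrow> 'a :: comm_ring"
  shows "(\<Sum>j\<in>J. c j * (\<Sum>s\<in>S. b j s * a s)) = (\<Sum>s\<in>S. (\<Sum>j\<in>J. c j * b j s) * a s)"
  by (simp add: sum_distrib_left sum_distrib_right mult.assoc) (rule sum.swap)

text \<open>Choose \<open>card J\<close> terms on which the coefficients of the slices in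
  \<open>J\<close> form an invertible matrix. From each slice subtract the combination of these
  slices that agrees with it on those terms, which then drop out. The products \<open>g\<close> stay
  the same, so the method can be repeated in another direction.\<close>

lemma substitution_method:
  fixes u :: "'i \<Rightarrow> 's \<Rightarrow> 'a :: field"
  assumes fin: "finite J" "finite S" and "J \<subseteq> I"
    and M: "\<forall>i\<in>I. \<forall>p\<in>P. M i p = (\<Sum>s\<in>S. u i s * g s p)"
    and indep: "\<forall>c. (\<forall>p\<in>P. (\<Sum>j\<in>J. c j * M j p) = 0) \<longrightarrow> (\<forall>j\<in>J. c j = 0)"
  shows "\<exists>S' c u'. finite S' \<and> card S' + card J = card S \<and>
    (\<forall>i\<in>I. \<forall>p\<in>P. M i p - (\<Sum>j\<in>J. c i j * M j p) = (\<Sum>s\<in>S'. u' i s * g s p))"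
proof -
  have lin: "(\<Sum>j\<in>J. c j * M j p) = (\<Sum>s\<in>S. (\<Sum>j\<in>J. c j * u j s) * g s p)" if "p \<in> P" for c p
  proof -
    have "(\<Sum>j\<in>J. c j * M j p) = (\<Sum>j\<in>J. c j * (\<Sum>s\<in>S. u j s * g s p))"
      using \<open>J \<subseteq> I\<close> that M by (intro sum.cong) auto
    then show ?thesis by (simp add: sum_linear_swap)
  qed
  have "\<exists>R\<subseteq>S. card R = card J \<and> (\<forall>t. \<exists>c. \<forall>s\<in>R. t s = (\<Sum>j\<in>J. c j * u j s))"
    by (rule independent_selection[OF fin], rule indep[rule_format]) (auto simp: lin)
  then obtain R where R: "R \<subseteq> S" "card R = card J"
    and sol: "\<And>t. \<exists>c. \<forall>s\<in>R. t s = (\<Sum>j\<in>J. c j * u j s)" by blast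
  have "\<forall>i. \<exists>c. \<forall>s\<in>R. u i s = (\<Sum>j\<in>J. c j * u j s)"
    using sol by simp
  then obtain c where "\<forall>i. \<forall>s\<in>R. u i s = (\<Sum>j\<in>J. c i j * u j s)"
    unfolding choice_iff by blast
  then have c: "u i s = (\<Sum>j\<in>J. c i j * u j s)" if "s \<in> R" for i s
    using that by blast
  define u' where "u' i s = u i s - (\<Sum>j\<in>J. c i j * u j s)" for i s
  have u'_0: "u' i s = 0" if "s \<in> R" for i s
    unfolding u'_def using c[OF that, of i] by (simp only: right_minus_eq)
  have "\<forall>i\<in>I. \<forall>p\<in>P. M i p - (\<Sum>j\<in>J. c i j * M j p) = (\<Sum>s\<in>S - R. u' i s * g s p)"
  proof (intro ballI)
    fix i p assume ip: "i \<in> I" "p \<in> P"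
    have "M i p - (\<Sum>j\<in>J. c i j * M j p) = (\<Sum>s\<in>S. u' i s * g s p)"
      using ip M by (simp add: lin u'_def sum_subtractf left_diff_distrib)
    also have "\<dots> = (\<Sum>s\<in>S - R. u' i s * g s p)"
      by (rule sum.mono_neutral_right) (use fin u'_0 in auto)
    finally show "M i p - (\<Sum>j\<in>J. c i j * M j p) = (\<Sum>s\<in>S - R. u' i s * g s p)" .
  qed
  moreover have "card (S - R) + card J = card S"
    using R fin by (metis card_Diff_subset card_mono finite_subset le_add_diff_inverse2)
  ultimately show ?thesis
    using finite_Diff[OF fin(2)] by blast
qed

text \<open>With \<open>I = J\<close>, the number of terms that survive is
  \<open>card S - card J\<close>, which forces the inequality.\<close>

lemma substitution_method_card_le:
  fixes u :: "'i \<Rightarrow> 's \<Rightarrow> 'a :: field"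
  assumes fin: "finite J" "finite S"
    and M: "\<forall>i\<in>J. \<forall>p\<in>P. M i p = (\<Sum>s\<in>S. u i s * g s p)"
    and indep: "\<forall>c. (\<forall>p\<in>P. (\<Sum>j\<in>J. c j * M j p) = 0) \<longrightarrow> (\<forall>j\<in>J. c j = 0)"
  shows "card J \<le> card S"
  using substitution_method[OF fin order.refl M indep] by (metis le_add2)

section \<open>Upper bound on the rank\<close>

lemma sum_of_bool_at_most_one:
  assumes "finite I" "\<And>i. i \<in> I \<Longrightarrow> Q i \<Longrightarrow> i = g"
  shows "(\<Sum>i\<in>I. of_bool (Q i)) = (of_bool (g \<in> I \<and> Q g) :: 'a :: semiring_1)"
proof -
  have "(\<Sum>i\<in>I. of_bool (Q i)) = (\<Sum>i\<in>I. if i = g then of_bool (Q g) else (0 :: 'a))"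
  proof (rule sum.cong)
    fix i assume "i \<in> I"
    then show "of_bool (Q i) = (if i = g then of_bool (Q g) else (0 :: 'a))"
      using assms(2)[of i] by (cases "i = g") auto
  qed simp
  then show ?thesis using assms(1) by simp
qed

lemma rank_T_biggap_upper:
  assumes "k \<ge> 1"
  shows "rank_at_most (2 * k + 1) (2 * k + 1) (2 * k + 1) (5 * k) (T_biggap k)"
proof -
  define d :: "nat \<Rightarrow> nat \<Rightarrow> complex" where "d p i = of_bool (i = p)" for p i
  define B where "B p i j l = simple_tensor (d (2 * k)) (d p) (d p) i j l
    + simple_tensor (d (2 * k)) (d (k + p)) (d (k + p)) i j l
    + simple_tensor (d 0) (d (k + p)) (d p) i j l
    + simple_tensor (d p) (d (k + p)) (d 0) i j l
    + simple_tensor (d (k + p)) (d (2 * k)) (d p) i j l" for p i j l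
  \<comment> \<open>Six entries are produced with five terms: the second term serves the slices
    \<open>2 * k\<close> and \<open>0\<close>, the fourth the slices \<open>2 * k\<close> and
    \<open>k\<close>, and the other three supply the missing entries and cancel the surplus.\<close>
  define C where "C i j l =
      simple_tensor (d (2 * k)) (\<lambda>j. d 0 j - d k j - d (2 * k) j) (d 0) i j l
    + simple_tensor (\<lambda>i. d (2 * k) i + d 0 i) (d k) (\<lambda>l. d 0 l + d k l) i j l
    + simple_tensor (d 0) (\<lambda>j. d (2 * k) j - d k j) (d k) i j l
    + simple_tensor (\<lambda>i. d (2 * k) i + d k i) (d (2 * k)) (\<lambda>l. d 0 l + d (2 * k) l) i j l
    + simple_tensor (\<lambda>i. - d k i) (d (2 * k)) (d (2 * k)) i j l" for i j l
  let ?m = "2 * k + 1"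
  have five: "rank_at_most ?m ?m ?m (1 + 1 + 1 + 1 + 1) (B p)" "rank_at_most ?m ?m ?m (1 + 1 + 1 + 1 + 1) C" for p
    unfolding B_def[abs_def] C_def[abs_def] by (intro rank_at_most_add rank_at_most_simple)+
  have BC: "rank_at_most ?m ?m ?m (card {1..<k} * (1 + 1 + 1 + 1 + 1) + (1 + 1 + 1 + 1 + 1))
      (\<lambda>i j l. (\<Sum>p\<in>{1..<k}. B p i j l) + C i j l)"
    by (intro rank_at_most_add rank_at_most_sum five) auto
  have B: "(\<Sum>p\<in>{1..<k}. B p i j l) =
      of_bool (i = 2 * k \<and> j = l \<and> 0 < j \<and> j < k) + of_bool (i = 2 * k \<and> j = l \<and> k < j \<and> j < 2 * k)
      + of_bool (i = 0 \<and> j = k + l \<and> 0 < l \<and> l < k) + of_bool (0 < i \<and> i < k \<and> j = k + i \<and> l = 0)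
      + of_bool (i = k + l \<and> j = 2 * k \<and> 0 < l \<and> l < k)" for i j l
  proof -
    have B': "B p i j l = of_bool (i = 2 * k \<and> j = p \<and> l = p) + of_bool (i = 2 * k \<and> j = k + p \<and> l = k + p)
      + of_bool (i = 0 \<and> j = k + p \<and> l = p) + of_bool (i = p \<and> j = k + p \<and> l = 0)
      + of_bool (i = k + p \<and> j = 2 * k \<and> l = p)" for p
      by (simp add: B_def simple_tensor_def d_def of_bool_conj)
    have "(\<Sum>p\<in>{1..<k}. of_bool (i = 2 * k \<and> j = p \<and> l = p)) = (of_bool (j \<in> {1..<k} \<and> i = 2 * k \<and> j = j \<and> l = j) :: complex)"
      "(\<Sum>p\<in>{1..<k}. of_bool (i = 2 * k \<and> j = k + p \<and> l = k + p)) = (of_bool (j - k \<in> {1..<k} \<and> i = 2 * k \<and> j = k + (j - k) \<and> l = k + (j - k)) :: complex)"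
      "(\<Sum>p\<in>{1..<k}. of_bool (i = 0 \<and> j = k + p \<and> l = p)) = (of_bool (l \<in> {1..<k} \<and> i = 0 \<and> j = k + l \<and> l = l) :: complex)"
      "(\<Sum>p\<in>{1..<k}. of_bool (i = p \<and> j = k + p \<and> l = 0)) = (of_bool (i \<in> {1..<k} \<and> i = i \<and> j = k + i \<and> l = 0) :: complex)"
      "(\<Sum>p\<in>{1..<k}. of_bool (i = k + p \<and> j = 2 * k \<and> l = p)) = (of_bool (l \<in> {1..<k} \<and> i = k + l \<and> j = 2 * k \<and> l = l) :: complex)"
      by (rule sum_of_bool_at_most_one; auto)+
    then show ?thesis
      unfolding B' sum.distrib by (intro arg_cong2[where f = "(+)"] arg_cong[where f = of_bool]) auto
  qed
  have "T_biggap k i j l = (\<Sum>p\<in>{1..<k}. B p i j l) + C i j l"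
    if "i < ?m" "j < ?m" "l < ?m" for i j l
  proof -
    have T: "T_biggap k i j l = of_bool (i = 2 * k \<and> j = l) + of_bool (i = 0 \<and> j = k + l)
      + of_bool (0 < i \<and> i \<le> k \<and> j = k + i \<and> l = 0) + of_bool (k < i \<and> i < 2 * k \<and> j = 2 * k \<and> i = k + l)"
      by (rule T_biggap_eq) (use assms that in auto)
    \<comment> \<open>Each kind of entry is divided between the pairs treated by \<open>B\<close>
      and the indices \<open>0\<close>, \<open>k\<close>, \<open>2 * k\<close> treated by
      \<open>C\<close>.\<close>
    have diag: "of_bool (i = 2 * k \<and> j = l) = of_bool (i = 2 * k \<and> j = l \<and> 0 < j \<and> j < k)
        + of_bool (i = 2 * k \<and> j = l \<and> k < j \<and> j < 2 * k)
        + (of_bool (i = 2 * k \<and> j = l \<and> (j = 0 \<or> j = k \<or> j = 2 * k)) :: complex)"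
      using assms that by (cases "j < k"; cases "j = 0"; cases "j = k"; cases "j < 2 * k") auto
    have sub: "of_bool (i = 0 \<and> j = k + l) = of_bool (i = 0 \<and> j = k + l \<and> 0 < l \<and> l < k)
        + (of_bool (i = 0 \<and> (j = k \<and> l = 0 \<or> j = 2 * k \<and> l = k)) :: complex)"
      using assms that by (cases "l = 0"; cases "l < k") auto
    have col: "of_bool (0 < i \<and> i \<le> k \<and> j = k + i \<and> l = 0)
        = of_bool (0 < i \<and> i < k \<and> j = k + i \<and> l = 0) + (of_bool (i = k \<and> j = 2 * k \<and> l = 0) :: complex)"
      using assms by (cases "i < k"; cases "i = k") auto
    have row: "(k < i \<and> i < 2 * k \<and> j = 2 * k \<and> i = k + l) = (i = k + l \<and> j = 2 * k \<and> 0 < l \<and> l < k)"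
      by auto
    have C: "C i j l = of_bool (i = 2 * k \<and> j = l \<and> (j = 0 \<or> j = k \<or> j = 2 * k))
        + of_bool (i = 0 \<and> (j = k \<and> l = 0 \<or> j = 2 * k \<and> l = k)) + of_bool (i = k \<and> j = 2 * k \<and> l = 0)"
    proof -
      have k: "k \<noteq> 0" using assms by simp
      have four: "q = 0 \<or> q = k \<or> q = 2 * k \<or> q \<noteq> 0 \<and> q \<noteq> k \<and> q \<noteq> 2 * k" for q
        by blast
      show ?thesis
        unfolding C_def simple_tensor_def d_def
        using four[of j] four[of l] four[of i] by (elim disjE) (simp_all add: k)
    qed
    show ?thesis
      unfolding T B C diag sub col row by (simp add: add_ac)
  qed
  with BC have "rank_at_most ?m ?m ?m (card {1..<k} * (1 + 1 + 1 + 1 + 1) + (1 + 1 + 1 + 1 + 1)) (T_biggap k)"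
    by (rule rank_at_most_cong)
  moreover have "card {1..<k} * (1 + 1 + 1 + 1 + 1) + (1 + 1 + 1 + 1 + 1) = 5 * k"
    using assms by (cases k) auto
  ultimately show ?thesis by (simp only:)
qed

section \<open>Lower bound on the rank\<close>

lemma rank_T_biggap_lower:
  assumes "k \<ge> 1" "rank_at_most (2 * k + 1) (2 * k + 1) (2 * k + 1) r (T_biggap k)"
  shows "5 * k \<le> r"
proof -
  define T where "T = T_biggap k"
  have T: "T i j l = of_bool (i = 2 * k \<and> j = l) + of_bool (i = 0 \<and> j = k + l)
      + of_bool (0 < i \<and> i \<le> k \<and> j = k + i \<and> l = 0) + of_bool (k < i \<and> i < 2 * k \<and> j = 2 * k \<and> i = k + l)"
    if "i \<le> 2 * k" "j \<le> 2 * k" "l \<le> 2 * k" for i j l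
    unfolding T_def by (rule T_biggap_eq) (use assms that in auto)
  obtain U V W where UVW: "\<And>i j l. i \<le> 2 * k \<Longrightarrow> j \<le> 2 * k \<Longrightarrow> l \<le> 2 * k \<Longrightarrow>
      T i j l = (\<Sum>s<r. U s i * V s j * W s l)"
    using assms(2) unfolding rank_at_most_def T_def simple_tensor_def by (auto simp: less_Suc_eq_le)
  \<comment> \<open>First substitution, in the rows \<open>j < k\<close>: in the columns below
    \<open>k\<close>, the slice \<open>2 * k\<close> restricts to an identity matrix there.\<close>
  have "\<exists>S1 c v. finite S1 \<and> card S1 + card {..<k} = card {..<r} \<and>
    (\<forall>j\<in>{..2 * k}. \<forall>p\<in>{..2 * k} \<times> {..2 * k}. T (fst p) j (snd p) - (\<Sum>j'<k. c j j' * T (fst p) j' (snd p))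
      = (\<Sum>s\<in>S1. v j s * (U s (fst p) * W s (snd p))))"
  proof (rule substitution_method[where u = "\<lambda>j s. V s j"])
    show "\<forall>j\<in>{..2 * k}. \<forall>p\<in>{..2 * k} \<times> {..2 * k}.
        T (fst p) j (snd p) = (\<Sum>s<r. V s j * (U s (fst p) * W s (snd p)))"
      by (auto simp: UVW mult_ac)
    show "\<forall>c. (\<forall>p\<in>{..2 * k} \<times> {..2 * k}. (\<Sum>j<k. c j * T (fst p) j (snd p)) = 0) \<longrightarrow> (\<forall>j\<in>{..<k}. c j = 0)"
    proof (intro allI impI ballI)
      fix c :: "nat \<Rightarrow> complex" and j
      assume c: "\<forall>p\<in>{..2 * k} \<times> {..2 * k}. (\<Sum>j<k. c j * T (fst p) j (snd p)) = 0" and j: "j \<in> {..<k}"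
      have "(\<Sum>j'<k. c j' * T (2 * k) j' j) = (\<Sum>j'<k. if j' = j then c j else 0)"
        using j assms(1) by (intro sum.cong) (auto simp: T)
      then show "c j = 0" using bspec[OF c, of "(2 * k, j)"] j by simp
    qed
  qed auto
  then obtain S1 c v where S1: "finite S1" "card S1 + card {..<k} = card {..<r}"
    and "\<forall>j\<in>{..2 * k}. \<forall>p\<in>{..2 * k} \<times> {..2 * k}. T (fst p) j (snd p) - (\<Sum>j'<k. c j j' * T (fst p) j' (snd p))
      = (\<Sum>s\<in>S1. v j s * (U s (fst p) * W s (snd p)))" by blast
  then have S1_eq: "T i j l - (\<Sum>j'<k. c j j' * T i j' l) = (\<Sum>s\<in>S1. v j s * (U s i * W s l))"
    if "i \<le> 2 * k" "j \<le> 2 * k" "l \<le> 2 * k" for i j l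
    using that by auto
  define T1 where "T1 i j l = T i j l - (\<Sum>j'<k. c j j' * T i j' l)" for i j l
  \<comment> \<open>The eliminated rows are zero in every slice \<open>i < 2 * k\<close>.\<close>
  have T1_small: "T1 i j l = T i j l" if "i < 2 * k" "j \<le> 2 * k" "l \<le> 2 * k" for i j l
    unfolding T1_def using that by (auto intro!: sum.neutral simp: T)
  \<comment> \<open>In slice \<open>2 * k\<close> the eliminated rows vanish in the columns beyond
    \<open>k\<close>, so the identity block there is intact for the second substitution.\<close>
  have T1_last: "T1 (2 * k) j l = of_bool (j = l)" if "j \<le> 2 * k" "k < l" "l \<le> 2 * k" for j l
    unfolding T1_def using that by (auto intro!: sum.neutral simp: T)
  have "\<exists>S2 d w. finite S2 \<and> card S2 + card {k<..2 * k} = card S1 \<and>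
    (\<forall>l\<in>{..2 * k}. \<forall>p\<in>{..2 * k} \<times> {..2 * k}.
      T1 (fst p) (snd p) l - (\<Sum>l'\<in>{k<..2 * k}. d l l' * T1 (fst p) (snd p) l')
      = (\<Sum>s\<in>S2. w l s * (U s (fst p) * v (snd p) s)))"
  proof (rule substitution_method[where u = "\<lambda>l s. W s l"])
    show "\<forall>l\<in>{..2 * k}. \<forall>p\<in>{..2 * k} \<times> {..2 * k}.
        T1 (fst p) (snd p) l = (\<Sum>s\<in>S1. W s l * (U s (fst p) * v (snd p) s))"
      by (auto simp: S1_eq T1_def mult_ac)
    show "\<forall>c. (\<forall>p\<in>{..2 * k} \<times> {..2 * k}. (\<Sum>l\<in>{k<..2 * k}. c l * T1 (fst p) (snd p) l) = 0)
        \<longrightarrow> (\<forall>l\<in>{k<..2 * k}. c l = 0)"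
    proof (intro allI impI ballI)
      fix c :: "nat \<Rightarrow> complex" and l
      assume c: "\<forall>p\<in>{..2 * k} \<times> {..2 * k}. (\<Sum>l\<in>{k<..2 * k}. c l * T1 (fst p) (snd p) l) = 0"
        and l: "l \<in> {k<..2 * k}"
      have "(\<Sum>l'\<in>{k<..2 * k}. c l' * T1 (2 * k) l l') = (\<Sum>l'\<in>{k<..2 * k}. if l' = l then c l else 0)"
        using l by (intro sum.cong) (auto simp: T1_last)
      then show "c l = 0" using bspec[OF c, of "(2 * k, l)"] l by simp
    qed
  qed (use S1 in auto)
  then obtain S2 d w where S2: "finite S2" "card S2 + card {k<..2 * k} = card S1"
    and "\<forall>l\<in>{..2 * k}. \<forall>p\<in>{..2 * k} \<times> {..2 * k}.
      T1 (fst p) (snd p) l - (\<Sum>l'\<in>{k<..2 * k}. d l l' * T1 (fst p) (snd p) l')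
      = (\<Sum>s\<in>S2. w l s * (U s (fst p) * v (snd p) s))" by blast
  then have S2_eq: "T1 i j l - (\<Sum>l'\<in>{k<..2 * k}. d l l' * T1 i j l') = (\<Sum>s\<in>S2. w l s * (U s i * v j s))"
    if "i \<le> 2 * k" "j \<le> 2 * k" "l \<le> 2 * k" for i j l
    using that by auto
  \<comment> \<open>The eliminated columns are zero in the slices \<open>i < 2 * k\<close>, so the
    corner block is still that of \<open>T\<close>, now with \<open>r - 2 * k\<close> terms. Slice
    \<open>2 * k\<close> is dropped from here on.\<close>
  have S2_T: "T i j l = (\<Sum>s\<in>S2. U s i * (v j s * w l s))"
    if "i < 2 * k" "k \<le> j" "j \<le> 2 * k" "l \<le> k" for i j l
  proof -
    have "(\<Sum>l'\<in>{k<..2 * k}. d l l' * T1 i j l') = 0"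
      using that by (intro sum.neutral) (auto simp: T1_small T)
    then show ?thesis using S2_eq[of i j l] that by (simp add: T1_small mult_ac)
  qed
  have "\<exists>S3 e u. finite S3 \<and> card S3 + card {1..<2 * k} = card S2 \<and>
    (\<forall>i\<in>{..<2 * k}. \<forall>p\<in>{k..2 * k} \<times> {..k}.
      T i (fst p) (snd p) - (\<Sum>i'\<in>{1..<2 * k}. e i i' * T i' (fst p) (snd p))
      = (\<Sum>s\<in>S3. u i s * (v (fst p) s * w (snd p) s)))"
  proof (rule substitution_method[where u = "\<lambda>i s. U s i"])
    show "\<forall>i\<in>{..<2 * k}. \<forall>p\<in>{k..2 * k} \<times> {..k}.
        T i (fst p) (snd p) = (\<Sum>s\<in>S2. U s i * (v (fst p) s * w (snd p) s))"
      by (auto simp: S2_T)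
    show "\<forall>c. (\<forall>p\<in>{k..2 * k} \<times> {..k}. (\<Sum>i\<in>{1..<2 * k}. c i * T i (fst p) (snd p)) = 0)
        \<longrightarrow> (\<forall>i\<in>{1..<2 * k}. c i = 0)"
    proof (intro allI impI ballI)
      fix c :: "nat \<Rightarrow> complex" and i
      assume c: "\<forall>p\<in>{k..2 * k} \<times> {..k}. (\<Sum>i\<in>{1..<2 * k}. c i * T i (fst p) (snd p)) = 0"
        and i: "i \<in> {1..<2 * k}"
      \<comment> \<open>The position in the corner of the only nonzero entry of slice
        \<open>i\<close>; these positions are distinct for distinct \<open>i\<close>.\<close>
      define p where "p = (if i \<le> k then (k + i, 0) else (2 * k, i - k))"
      have p: "p \<in> {k..2 * k} \<times> {..k}" using i by (auto simp: p_def)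
      have "(\<Sum>i'\<in>{1..<2 * k}. c i' * T i' (fst p) (snd p)) = (\<Sum>i'\<in>{1..<2 * k}. if i' = i then c i else 0)"
        using i by (intro sum.cong) (auto simp: T p_def)
      then show "c i = 0" using bspec[OF c p] i by simp
    qed
  qed (use S2 in auto)
  then obtain S3 e u where S3: "finite S3" "card S3 + card {1..<2 * k} = card S2"
    and "\<forall>i\<in>{..<2 * k}. \<forall>p\<in>{k..2 * k} \<times> {..k}.
      T i (fst p) (snd p) - (\<Sum>i'\<in>{1..<2 * k}. e i i' * T i' (fst p) (snd p))
      = (\<Sum>s\<in>S3. u i s * (v (fst p) s * w (snd p) s))" by blast
  then have S3_eq: "T i j l - (\<Sum>i'\<in>{1..<2 * k}. e i i' * T i' j l) = (\<Sum>s\<in>S3. u i s * (v j s * w l s))"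
    if "i < 2 * k" "k \<le> j" "j \<le> 2 * k" "l \<le> k" for i j l
    using that by auto
  define G where "G l j = T 0 j l - (\<Sum>i'\<in>{1..<2 * k}. e 0 i' * T i' j l)" for l j
  \<comment> \<open>The subtracted slices live in the first column and the last row, strictly below
    the diagonal of the corner block.\<close>
  have G: "G l (k + j) = of_bool (j = l)" if "j \<le> l" "l \<le> k" for j l
  proof -
    have "(\<Sum>i'\<in>{1..<2 * k}. e 0 i' * T i' (k + j) l) = 0"
      using that by (intro sum.neutral) (auto simp: T)
    then show ?thesis using that assms(1) by (simp add: G_def T)
  qed
  \<comment> \<open>By triangularity the \<open>k + 1\<close> columns of \<open>G\<close> are
    independent. The total is \<open>k + k + (2 * k - 1) + (k + 1) = 5 * k\<close>.\<close>
  have "card {..k} \<le> card S3"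
  proof (rule substitution_method_card_le[where u = "\<lambda>l s. w l s"])
    show "\<forall>l\<in>{..k}. \<forall>j\<in>{k..2 * k}. G l j = (\<Sum>s\<in>S3. w l s * (u 0 s * v j s))"
      using S3_eq[of 0] assms(1) by (simp add: G_def mult_ac)
    show "\<forall>c. (\<forall>j\<in>{k..2 * k}. (\<Sum>l\<le>k. c l * G l j) = 0) \<longrightarrow> (\<forall>l\<in>{..k}. c l = 0)"
    proof (intro allI impI ballI)
      fix c :: "nat \<Rightarrow> complex" and l
      assume c: "\<forall>j\<in>{k..2 * k}. (\<Sum>l\<le>k. c l * G l j) = 0" and "l \<in> {..k}"
      then show "c l = 0"
      proof (induction l rule: less_induct)
        case (less l)
        have "(\<Sum>l'\<le>k. c l' * G l' (k + l)) = (\<Sum>l'\<le>k. if l' = l then c l else 0)"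
        proof (rule sum.cong)
          fix l' assume "l' \<in> {..k}"
          then show "c l' * G l' (k + l) = (if l' = l then c l else 0)"
            using less.IH[of l'] less.prems by (cases "l' < l") (auto simp: G)
        qed simp
        then show ?case using less.prems by simp
      qed
    qed
  qed (use S3 in auto)
  then show ?thesis using S1 S2 S3 assms(1) by simp
qed

section \<open>Lower bound on the border rank\<close>

lemma border_rank_T_biggap_lower:
  assumes "k \<ge> 1"
  shows "2 * k + 1 \<le> border_rank (2 * k + 1) (2 * k + 1) (2 * k + 1) (T_biggap k)"
proof -
  let ?m = "2 * k + 1"
  let ?r = "border_rank ?m ?m ?m (T_biggap k)"
  obtain S where S: "\<And>n. rank_at_most ?m ?m ?m ?r (S n)"
    and lim: "\<And>i j l. i < ?m \<Longrightarrow> j < ?m \<Longrightarrow> l < ?m \<Longrightarrow> (\<lambda>n. S n i j l) \<longlonglongrightarrow> T_biggap k i j l"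
    using border_rank_sequence[of ?m ?m ?m "T_biggap k"] by blast
  have "(\<lambda>n. S n (2 * k) j l) \<longlonglongrightarrow> of_bool (j = l)" if "j < ?m" "l < ?m" for j l
    using lim[of "2 * k" j l] that assms by (simp add: T_biggap_eq)
  \<comment> \<open>With this tolerance the \<open>m\<close> errors in a column add up to less than
    1/2, which keeps the slice invertible.\<close>
  then have "\<forall>\<^sub>F n in sequentially. dist (S n (2 * k) j l) (of_bool (j = l)) < 1 / (2 * real ?m)"
    if "j < ?m" "l < ?m" for j l
    using that by (intro tendstoD) auto
  then have "\<forall>\<^sub>F n in sequentially. \<forall>j\<in>{..<?m}. \<forall>l\<in>{..<?m}. dist (S n (2 * k) j l) (of_bool (j = l)) < 1 / (2 * real ?m)"
    by (intro eventually_ball_finite ballI finite_lessThan) (unfold lessThan_iff, blast)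
  then obtain n where n: "\<And>j l. j < ?m \<Longrightarrow> l < ?m \<Longrightarrow> dist (S n (2 * k) j l) (of_bool (j = l)) < 1 / (2 * real ?m)"
    using eventually_happens'[OF sequentially_bot] by (metis (no_types, lifting) lessThan_iff)
  obtain U V W where UVW: "\<And>j l. j < ?m \<Longrightarrow> l < ?m \<Longrightarrow>
      S n (2 * k) j l = (\<Sum>s<?r. U s (2 * k) * V s j * W s l)"
    using S[of n] unfolding rank_at_most_def simple_tensor_def by auto
  have "card {..<?m} \<le> card {..<?r}"
  proof (rule substitution_method_card_le[where u = "\<lambda>j s. V s j"])
    show "\<forall>j\<in>{..<?m}. \<forall>l\<in>{..<?m}. S n (2 * k) j l = (\<Sum>s<?r. V s j * (U s (2 * k) * W s l))"
    proof (intro ballI)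
      fix j l assume "j \<in> {..<?m}" "l \<in> {..<?m}"
      then have "S n (2 * k) j l = (\<Sum>s<?r. U s (2 * k) * V s j * W s l)"
        by (intro UVW) auto
      also have "\<dots> = (\<Sum>s<?r. V s j * (U s (2 * k) * W s l))"
        by (simp only: mult.assoc mult.left_commute)
      finally show "S n (2 * k) j l = (\<Sum>s<?r. V s j * (U s (2 * k) * W s l))" .
    qed
    show "\<forall>c. (\<forall>l\<in>{..<?m}. (\<Sum>j<?m. c j * S n (2 * k) j l) = 0) \<longrightarrow> (\<forall>j\<in>{..<?m}. c j = 0)"
    proof (intro allI impI ballI)
      fix c :: "nat \<Rightarrow> complex" and j
      assume c: "\<forall>l\<in>{..<?m}. (\<Sum>j<?m. c j * S n (2 * k) j l) = 0" and j: "j \<in> {..<?m}"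
      \<comment> \<open>In a relation between the rows, the largest coefficient is bounded by half
        of itself, hence is zero.\<close>
      define x where "x = Max ((\<lambda>j. norm (c j)) ` {..<?m})"
      have x: "norm (c j) \<le> x" if "j < ?m" for j
        unfolding x_def using that by (intro Max_ge) auto
      have "x \<in> (\<lambda>j. norm (c j)) ` {..<?m}"
        unfolding x_def by (rule Max_in) auto
      then obtain l where l: "l < ?m" "x = norm (c l)" by auto
      have "c l = (\<Sum>j<?m. c j * of_bool (j = l)) - (\<Sum>j<?m. c j * S n (2 * k) j l)"
      proof -
        have "(\<Sum>j<?m. c j * of_bool (j = l)) = (\<Sum>j<?m. if j = l then c l else 0)"
          by (intro sum.cong) auto
        then show ?thesis using bspec[OF c, of l] l by simp
      qed
      also have "\<dots> = (\<Sum>j<?m. c j * (of_bool (j = l) - S n (2 * k) j l))"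
        by (simp add: sum_subtractf right_diff_distrib)
      finally have "x \<le> (\<Sum>j<?m. norm (c j * (of_bool (j = l) - S n (2 * k) j l)))"
        using l by (metis norm_sum)
      also have "\<dots> \<le> (\<Sum>j<?m. x * (1 / (2 * real ?m)))"
      proof (rule sum_mono)
        fix j assume "j \<in> {..<?m}"
        then show "norm (c j * (of_bool (j = l) - S n (2 * k) j l)) \<le> x * (1 / (2 * real ?m))"
          unfolding norm_mult using n[of j l] l x[of j]
          by (intro mult_mono) (auto simp: dist_norm norm_minus_commute)
      qed
      also have "\<dots> = real ?m * (x * (1 / (2 * real ?m)))"
        by (simp only: sum_constant card_lessThan)
      also have "\<dots> = x / 2"
      proof -
        have "y * (x * (1 / (2 * y))) = x / 2" if "y \<noteq> 0" for y
          using that by simp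
        then show ?thesis by (simp only: of_nat_eq_0_iff)
      qed
      finally have "x \<le> 0" by simp
      then show "c j = 0" using x[of j] j by (metis lessThan_iff norm_le_zero_iff order.trans)
    qed
  qed auto
  then show ?thesis by simp
qed


section \<open>Upper bound on the border rank by degeneration\<close>

lemma rank_at_most_scale:
  assumes "rank_at_most a b c r T"
  shows "rank_at_most a b c r (\<lambda>i j l. f i * g j * h l * T i j l)"
proof -
  obtain u v w where T: "\<forall>i<a. \<forall>j<b. \<forall>l<c. T i j l = (\<Sum>s<r. simple_tensor (u s) (v s) (w s) i j l)"
    using assms unfolding rank_at_most_def by blast
  show ?thesis
    unfolding rank_at_most_def
    by (rule exI[of _ "\<lambda>s i. f i * u s i"], rule exI[of _ "\<lambda>s j. g j * v s j"], rule exI[of _ "\<lambda>s l. h l * w s l"])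
      (simp add: T simple_tensor_def sum_distrib_left mult_ac)
qed

text \<open>Scale the entry \<open>(i, j, l)\<close> of \<open>S\<close> by
  \<open>e ^ (g j + h l - d i)\<close> and let \<open>e\<close> tend to 0. By \<open>low\<close> no
  negative power survives, positive powers vanish in the limit, and exponent zero leaves
  \<open>T\<close>.\<close>

lemma border_rank_le_of_degeneration:
  fixes d g h :: "nat \<Rightarrow> nat"
  assumes rank: "rank_at_most a b c r S"
    and low: "\<And>i j l. i < a \<Longrightarrow> j < b \<Longrightarrow> l < c \<Longrightarrow> g j + h l < d i \<Longrightarrow> S i j l = 0"
    and init: "\<And>i j l. i < a \<Longrightarrow> j < b \<Longrightarrow> l < c \<Longrightarrow>
      T i j l = (if g j + h l = d i then S i j l else 0)"
  shows "border_rank a b c T \<le> r"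
proof -
  define e :: "nat \<Rightarrow> complex" where "e n = of_real (inverse (real (Suc n)))" for n
  have e0: "e n \<noteq> 0" for n unfolding e_def of_real_eq_0_iff by simp
  have e_lim: "e \<longlonglongrightarrow> 0"
    unfolding e_def[abs_def] using tendsto_of_real[OF LIMSEQ_inverse_real_of_nat, where 'a = complex] by simp
  show ?thesis
  proof (rule border_rank_le)
    show "rank_at_most a b c r (\<lambda>i j l. inverse (e n ^ d i) * e n ^ g j * e n ^ h l * S i j l)" for n
      by (rule rank_at_most_scale[OF rank])
    fix i j l assume ijl: "i < a" "j < b" "l < c"
    have eq_pow: "inverse (e n ^ d i) * e n ^ g j * e n ^ h l * S i j l = e n ^ (g j + h l - d i) * S i j l"
      if "d i \<le> g j + h l" for n
      using that e0[of n] by (simp add: power_diff power_add field_simps)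
    consider "g j + h l < d i" | "g j + h l = d i" | "d i < g j + h l" by linarith
    then show "(\<lambda>n. inverse (e n ^ d i) * e n ^ g j * e n ^ h l * S i j l) \<longlonglongrightarrow> T i j l"
    proof cases
      case 1
      then show ?thesis using low[OF ijl] init[OF ijl] by simp
    next
      case 2
      then show ?thesis unfolding eq_pow[OF eq_refl[OF 2[symmetric]]] using init[OF ijl] by simp
    next
      case 3
      have "(\<lambda>n. e n ^ (g j + h l - d i) * S i j l) \<longlonglongrightarrow> 0 ^ (g j + h l - d i) * S i j l"
        by (intro tendsto_intros e_lim)
      then show ?thesis unfolding eq_pow[OF less_imp_le[OF 3]] using 3 init[OF ijl] by (simp add: zero_power)
    qed
  qed
qed

lemma border_rank_T_biggap_upper:
  assumes "k \<ge> 1"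
  shows "border_rank (2 * k + 1) (2 * k + 1) (2 * k + 1) (T_biggap k) \<le> 2 * k + 2"
proof -
  let ?m = "2 * k + 1"
  \<comment> \<open>Row \<open>j\<close> gets weight \<open>4 - \<gamma> j\<close>, column \<open>l\<close> weight \<open>\<gamma> l\<close> and slice \<open>i\<close> weight \<open>d i\<close>. A point
     \<open>row t A \<otimes> col t B\<close> is an approximate joint eigenprojection with eigenvalue \<open>t\<close> of the slice of \<open>x 0\<close>.
     The first point of \<open>R\<close> is the slice of \<open>x k\<close> itself; the other three balance the points of \<open>PQ\<close>,
     so that everything below weight \<open>d i\<close> cancels.\<close>
  define \<gamma> :: "nat \<Rightarrow> nat" where
    "\<gamma> j = (if j = 0 then 0 else if j < k then 1 else if j = k then 2 else if j < 2 * k then 3 else 4)" for j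
  define d :: "nat \<Rightarrow> nat" where
    "d i = (if i = 2 * k then 4 else if i = 0 then 2 else if i = k then 0 else 1)" for i
  define row :: "complex \<Rightarrow> (nat \<Rightarrow> complex) \<Rightarrow> nat \<Rightarrow> complex" where
    "row t A j = t ^ ((4 - \<gamma> j) div 2) * (if odd (\<gamma> j) then A (j mod k) else 1)" for t A j
  define col :: "complex \<Rightarrow> (nat \<Rightarrow> complex) \<Rightarrow> nat \<Rightarrow> complex" where
    "col t B l = t ^ (\<gamma> l div 2) * (if odd (\<gamma> l) then B (l mod k) else 1)" for t B l
  define \<delta> :: "nat \<Rightarrow> nat \<Rightarrow> complex" where "\<delta> p i = of_bool (i = p)" for p i
  define uP where "uP p i = - \<delta> (2 * k) i / 2 + \<delta> 0 i / 2 + \<delta> p i / 2 + \<delta> (k + p) i / 2" for p i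
  define uQ where "uQ p i = - \<delta> (2 * k) i / 2 - \<delta> 0 i / 2 + \<delta> p i / 2 - \<delta> (k + p) i / 2" for p i
  define PQ where "PQ p i j l = simple_tensor (uP p) (row (-1) (\<delta> p)) (col (-1) (\<delta> p)) i j l
    + simple_tensor (uQ p) (row 1 (\<delta> p)) (col 1 (\<lambda>i. - \<delta> p i)) i j l" for p i j l
  define R where "R i j l =
      simple_tensor (\<lambda>i. \<delta> k i - of_bool (0 < i \<and> i < k)) (row 0 (\<lambda>_. 0)) (col 0 (\<lambda>_. 0)) i j l
    + simple_tensor (\<lambda>i. - \<delta> (2 * k) i) (row 0 (\<lambda>_. - 1)) (col 0 (\<lambda>_. 0)) i j l
    + simple_tensor (\<lambda>i. of_nat k / 2 * (\<delta> (2 * k) i + \<delta> 0 i)) (row 1 (\<lambda>_. 0)) (col 1 (\<lambda>_. - 1 / of_nat k)) i j l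
    + simple_tensor (\<lambda>i. of_nat k / 2 * (\<delta> (2 * k) i - \<delta> 0 i)) (row (-1) (\<lambda>_. 0)) (col (-1) (\<lambda>_. 1 / of_nat k)) i j l" for i j l
  define S where "S i j l = (\<Sum>p\<in>{1..<k}. PQ p i j l) + R i j l" for i j l
  have S_rank: "rank_at_most ?m ?m ?m (2 * k + 2) S"
  proof -
    have "rank_at_most ?m ?m ?m (1 + 1) (PQ p)" "rank_at_most ?m ?m ?m (1 + 1 + 1 + 1) R" for p
      unfolding PQ_def[abs_def] R_def[abs_def] by (intro rank_at_most_add rank_at_most_simple)+
    then have "rank_at_most ?m ?m ?m (card {1..<k} * (1 + 1) + (1 + 1 + 1 + 1)) S"
      unfolding S_def[abs_def] by (intro rank_at_most_add rank_at_most_sum) auto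
    moreover have "card {1..<k} * (1 + 1) + (1 + 1 + 1 + 1) = 2 * k + 2"
      using assms by (cases k) auto
    ultimately show ?thesis by (simp only:)
  qed
  have k: "k \<noteq> 0" using assms by simp
  have \<gamma>: "\<gamma> 0 = 0" "\<gamma> k = 2" "\<gamma> (2 * k) = 4" "\<And>a. 0 < a \<Longrightarrow> a < k \<Longrightarrow> \<gamma> a = 1"
    "\<And>a. 0 < a \<Longrightarrow> a < k \<Longrightarrow> \<gamma> (k + a) = 3"
    using k by (auto simp: \<gamma>_def)
  have row: "row t A 0 = t\<^sup>2" "row t A k = t" "row t A (2 * k) = 1"
    "\<And>a. 0 < a \<Longrightarrow> a < k \<Longrightarrow> row t A a = t * A a"
    "\<And>a. 0 < a \<Longrightarrow> a < k \<Longrightarrow> row t A (k + a) = A a" for t A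
    by (simp_all add: row_def \<gamma>)
  have col: "col t A 0 = 1" "col t A k = t" "col t A (2 * k) = t\<^sup>2"
    "\<And>a. 0 < a \<Longrightarrow> a < k \<Longrightarrow> col t A a = A a"
    "\<And>a. 0 < a \<Longrightarrow> a < k \<Longrightarrow> col t A (k + a) = t * A a" for t A
    by (simp_all add: col_def \<gamma>)
  have index: "q = 0 \<or> (\<exists>a. 0 < a \<and> a < k \<and> q = a) \<or> q = k \<or> (\<exists>a. 0 < a \<and> a < k \<and> q = k + a) \<or> q = 2 * k"
    if "q < ?m" for q
  proof (cases "k < q \<and> q < 2 * k")
    case True
    then have "0 < q - k \<and> q - k < k \<and> q = k + (q - k)" by auto
    then show ?thesis by blast
  next
    case False
    then show ?thesis using that by auto
  qed
  \<comment> \<open>\<open>Z\<close> is the sum over \<open>p\<close> of the factors of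
    \<open>PQ\<close> other than powers of \<open>t\<close>. Both points share it up to
    sign.\<close>
  define Z where "Z j l = (\<Sum>p\<in>{1..<k}. (if odd (\<gamma> j) then \<delta> p (j mod k) else 1) * (if odd (\<gamma> l) then \<delta> p (l mod k) else 1))" for j l
  have sum\<delta>: "(\<Sum>p\<in>{1..<k}. f p * \<delta> p a) = f a" "(\<Sum>p\<in>{1..<k}. \<delta> p a * f p) = f a" "(\<Sum>p\<in>{1..<k}. \<delta> p a) = 1"
    if "0 < a" "a < k" for a :: nat and f
  proof -
    have *: "(\<Sum>p\<in>{1..<k}. f p * \<delta> p a) = f a" for f
    proof -
      have "(\<Sum>p\<in>{1..<k}. f p * \<delta> p a) = (\<Sum>p\<in>{1..<k}. if p = a then f a else 0)"
        by (intro sum.cong) (auto simp: \<delta>_def)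
      then show ?thesis using that by simp
    qed
    show "(\<Sum>p\<in>{1..<k}. f p * \<delta> p a) = f a" "(\<Sum>p\<in>{1..<k}. \<delta> p a * f p) = f a"
      using *[of f] by (simp_all add: mult.commute)
    show "(\<Sum>p\<in>{1..<k}. \<delta> p a) = 1" using *[of "\<lambda>_. 1"] by simp
  qed
  \<comment> \<open>Odd \<open>\<gamma>\<close> singles out the indices \<open>a\<close> and
    \<open>k + a\<close> with \<open>0 < a < k\<close>; reduction modulo \<open>k\<close> sends both
    to \<open>a\<close>, in the range of \<open>p\<close>.\<close>
  have mod_pos: "0 < j mod k" "j mod k < k" if odd: "odd (\<gamma> j)" for j
  proof -
    have "0 < j \<and> j < k \<or> k < j \<and> j < 2 * k"
      using odd by (auto simp: \<gamma>_def split: if_splits)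
    then show "0 < j mod k"
    proof
      assume "k < j \<and> j < 2 * k"
      then have "j mod k = j - k" by (auto simp: mod_if)
      then show ?thesis using \<open>k < j \<and> j < 2 * k\<close> by simp
    qed simp
    show "j mod k < k" using k by simp
  qed
  have Z: "even (\<gamma> j) \<Longrightarrow> even (\<gamma> l) \<Longrightarrow> Z j l = of_nat k - 1"
    "odd (\<gamma> j) \<Longrightarrow> even (\<gamma> l) \<Longrightarrow> Z j l = 1"
    "even (\<gamma> j) \<Longrightarrow> odd (\<gamma> l) \<Longrightarrow> Z j l = 1"
    "odd (\<gamma> j) \<Longrightarrow> odd (\<gamma> l) \<Longrightarrow> Z j l = of_bool (j mod k = l mod k)" for j l
  proof -
    show "even (\<gamma> j) \<Longrightarrow> even (\<gamma> l) \<Longrightarrow> Z j l = of_nat k - 1"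
      using assms by (simp add: Z_def of_nat_diff)
    show "odd (\<gamma> j) \<Longrightarrow> even (\<gamma> l) \<Longrightarrow> Z j l = 1" "even (\<gamma> j) \<Longrightarrow> odd (\<gamma> l) \<Longrightarrow> Z j l = 1"
      by (simp_all add: Z_def sum\<delta>[OF mod_pos, simplified])
    assume o: "odd (\<gamma> j)" "odd (\<gamma> l)"
    have "Z j l = (\<Sum>p\<in>{1..<k}. \<delta> p (j mod k) * \<delta> p (l mod k))"
      using o by (simp add: Z_def)
    also have "\<dots> = \<delta> (l mod k) (j mod k)"
      by (rule sum\<delta>(1)[OF mod_pos[OF o(2)]])
    finally show "Z j l = of_bool (j mod k = l mod k)" by (simp add: \<delta>_def)
  qed
  have sum_P: "(\<Sum>p\<in>{1..<k}. row (-1) (\<delta> p) j * col (-1) (\<delta> p) l)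
      = (-1) ^ ((4 - \<gamma> j) div 2) * (-1) ^ (\<gamma> l div 2) * Z j l" for j l
    unfolding Z_def sum_distrib_left row_def col_def by (simp only: mult_ac)
  have sum_Q: "(\<Sum>p\<in>{1..<k}. row 1 (\<delta> p) j * col 1 (\<lambda>i. - \<delta> p i) l)
      = (if odd (\<gamma> l) then -1 else 1) * Z j l" for j l
    unfolding Z_def sum_distrib_left row_def col_def by (intro sum.cong) simp_all
  \<comment> \<open>At \<open>(2 * k, 0)\<close> the sum is \<open>- (k - 1) - 1 + k = 0\<close>. At
    \<open>(k + a, 0)\<close> the vector \<open>-1\<close> in the second term of \<open>R\<close>
    cancels the -1 left by \<open>PQ\<close>.\<close>
  have S_last: "S (2 * k) j l = - (((-1) ^ ((4 - \<gamma> j) div 2) * (-1) ^ (\<gamma> l div 2)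
        + (if odd (\<gamma> l) then -1 else 1)) * Z j l) / 2
      - row 0 (\<lambda>_. -1) j * col 0 (\<lambda>_. 0) l
      + of_nat k / 2 * (row 1 (\<lambda>_. 0) j * col 1 (\<lambda>_. - 1 / of_nat k) l
        + row (-1) (\<lambda>_. 0) j * col (-1) (\<lambda>_. 1 / of_nat k) l)" for j l
  proof -
    have "(\<Sum>p\<in>{1..<k}. PQ p (2 * k) j l) = (\<Sum>p\<in>{1..<k}. (- 1 / 2) * (row (-1) (\<delta> p) j * col (-1) (\<delta> p) l
      + row 1 (\<delta> p) j * col 1 (\<lambda>i. - \<delta> p i) l))"
      using k by (intro sum.cong) (simp_all add: PQ_def uP_def uQ_def simple_tensor_def \<delta>_def distrib_left)
    also have "\<dots> = (- 1 / 2) * (((-1) ^ ((4 - \<gamma> j) div 2) * (-1) ^ (\<gamma> l div 2)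
        + (if odd (\<gamma> l) then -1 else 1)) * Z j l)"
      unfolding sum_distrib_left[symmetric] sum.distrib sum_P sum_Q distrib_right ..
    finally show ?thesis
      using k by (simp add: S_def R_def simple_tensor_def \<delta>_def distrib_left mult.assoc)
  qed
  \<comment> \<open>Each point enters with \<open>t\<close> times its coefficient in slice
    \<open>2 * k\<close>. At \<open>(2 * k, a)\<close> with \<open>0 < a < k\<close>, the vectors of
    size \<open>1 / k\<close> in \<open>R\<close> cancel the 1 left by \<open>PQ\<close>.\<close>
  have S_0: "S 0 j l = (((-1) ^ ((4 - \<gamma> j) div 2) * (-1) ^ (\<gamma> l div 2)
        - (if odd (\<gamma> l) then -1 else 1)) * Z j l) / 2
      + of_nat k / 2 * (row 1 (\<lambda>_. 0) j * col 1 (\<lambda>_. - 1 / of_nat k) l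
        - row (-1) (\<lambda>_. 0) j * col (-1) (\<lambda>_. 1 / of_nat k) l)" for j l
  proof -
    have "(\<Sum>p\<in>{1..<k}. PQ p 0 j l) = (\<Sum>p\<in>{1..<k}. (1 / 2) * (row (-1) (\<delta> p) j * col (-1) (\<delta> p) l
      - row 1 (\<delta> p) j * col 1 (\<lambda>i. - \<delta> p i) l))"
      using k by (intro sum.cong) (simp_all add: PQ_def uP_def uQ_def simple_tensor_def \<delta>_def right_diff_distrib)
    also have "\<dots> = (1 / 2) * (((-1) ^ ((4 - \<gamma> j) div 2) * (-1) ^ (\<gamma> l div 2)
        - (if odd (\<gamma> l) then -1 else 1)) * Z j l)"
      unfolding sum_distrib_left[symmetric] sum_subtractf sum_P sum_Q left_diff_distrib ..
    finally show ?thesis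
      using k by (simp add: S_def R_def simple_tensor_def \<delta>_def right_diff_distrib mult.assoc)
  qed
  have S_k: "S k j l = row 0 (\<lambda>_. 0) j * col 0 (\<lambda>_. 0) l" for j l
  proof -
    have "(\<Sum>p\<in>{1..<k}. PQ p k j l) = 0"
      using k by (intro sum.neutral) (simp add: PQ_def uP_def uQ_def simple_tensor_def \<delta>_def)
    then show ?thesis
      using k by (simp add: S_def R_def simple_tensor_def \<delta>_def)
  qed
  \<comment> \<open>The two points of \<open>PQ q\<close> have column vectors of opposite sign, so
    in weight 1 half their sum keeps only the entry \<open>(k + q, 0)\<close>. The subtracted term
    removes the weight 0 entry \<open>(2 * k, 0)\<close>.\<close>
  have S_col: "S q j l = (row (-1) (\<delta> q) j * col (-1) (\<delta> q) l + row 1 (\<delta> q) j * col 1 (\<lambda>i. - \<delta> q i) l) / 2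
      - row 0 (\<lambda>_. 0) j * col 0 (\<lambda>_. 0) l" if "0 < q" "q < k" for q j l
  proof -
    have "(\<Sum>p\<in>{1..<k}. PQ p q j l) = (\<Sum>p\<in>{1..<k}. if p = q then
        (row (-1) (\<delta> q) j * col (-1) (\<delta> q) l + row 1 (\<delta> q) j * col 1 (\<lambda>i. - \<delta> q i) l) / 2 else 0)"
      using that by (intro sum.cong) (auto simp: PQ_def uP_def uQ_def simple_tensor_def \<delta>_def add_divide_distrib)
    then show ?thesis
      using that by (simp add: S_def R_def simple_tensor_def \<delta>_def)
  qed
  \<comment> \<open>Half the difference keeps, in weight 1, only the entry
    \<open>(2 * k, q)\<close>; weight 0 cancels by itself.\<close>
  have S_row: "S (k + q) j l = (row (-1) (\<delta> q) j * col (-1) (\<delta> q) l - row 1 (\<delta> q) j * col 1 (\<lambda>i. - \<delta> q i) l) / 2"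
    if "0 < q" "q < k" for q j l
  proof -
    have "(\<Sum>p\<in>{1..<k}. PQ p (k + q) j l) = (\<Sum>p\<in>{1..<k}. if p = q then
        (row (-1) (\<delta> q) j * col (-1) (\<delta> q) l - row 1 (\<delta> q) j * col 1 (\<lambda>i. - \<delta> q i) l) / 2 else 0)"
      using that by (intro sum.cong) (auto simp: PQ_def uP_def uQ_def simple_tensor_def \<delta>_def diff_divide_distrib)
    then show ?thesis
      using that by (simp add: S_def R_def simple_tensor_def \<delta>_def)
  qed
  \<comment> \<open>Weights depend only on the type of an index in \<open>index\<close>, so five
    types of slices, rows and columns are to be checked.\<close>
  have degen: "(4 - \<gamma> j + \<gamma> l < d i \<longrightarrow> S i j l = 0) \<and> T_biggap k i j l = (if 4 - \<gamma> j + \<gamma> l = d i then S i j l else 0)"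
    if ijl: "i < ?m" "j < ?m" "l < ?m" for i j l
  proof -
    have T: "T_biggap k i j l = of_bool (i = 2 * k \<and> j = l) + of_bool (i = 0 \<and> j = k + l)
      + of_bool (0 < i \<and> i \<le> k \<and> j = k + i \<and> l = 0) + of_bool (k < i \<and> i < 2 * k \<and> j = 2 * k \<and> i = k + l)"
      by (rule T_biggap_eq) (use assms ijl in auto)
    consider "i = 2 * k" | "i = 0" | "i = k" | q where "0 < q" "q < k" "i = q" | q where "0 < q" "q < k" "i = k + q"
      using index[OF ijl(1)] by blast
    then show ?thesis
    proof cases
      case 1
      then show ?thesis
        using index[OF ijl(2)] index[OF ijl(3)] k unfolding T
        by (elim disjE exE conjE, simp_all add: \<gamma> d_def row col, simp_all only: S_last row col \<gamma>)
            (simp_all add: Z \<gamma> diff_divide_distrib)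
    next
      case 2
      then show ?thesis
        using index[OF ijl(2)] index[OF ijl(3)] k unfolding T
        by (elim disjE exE conjE, simp_all add: \<gamma> d_def row col, simp_all only: S_0 row col \<gamma>)
            (simp_all add: Z \<gamma> diff_divide_distrib)
    next
      case 3
      then show ?thesis
        using index[OF ijl(2)] index[OF ijl(3)] k unfolding T
        by (elim disjE exE conjE) (simp_all add: \<gamma> d_def S_k row col)
    next
      case 4
      then show ?thesis
        using index[OF ijl(2)] index[OF ijl(3)] k unfolding T
        by (elim disjE exE conjE) (simp_all add: \<gamma> d_def S_col row col \<delta>_def)
    next
      case 5
      then show ?thesis
        using index[OF ijl(2)] index[OF ijl(3)] k unfolding T
        by (elim disjE exE conjE) (simp_all add: \<gamma> d_def S_row row col \<delta>_def)
    qed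
  qed
  show ?thesis
    by (rule border_rank_le_of_degeneration[OF S_rank, where g = "\<lambda>j. 4 - \<gamma> j" and h = \<gamma> and d = d])
      (use degen in blast)+
qed

section \<open>The combined bounds and the limit of the ratio\<close>

theorem theorem6p12:
  "(\<forall>k m :: nat. k \<ge> 1 \<and> m = 2 * k + 1 \<longrightarrow>
      m \<le> border_rank m m m (T_biggap k) \<and>
      border_rank m m m (T_biggap k) \<le> m + 1 \<and>
      real (tensor_rank m m m (T_biggap k)) = 5 / 2 * (real m - 1)) \<and>
   (\<lambda>k. real (tensor_rank (2 * k + 1) (2 * k + 1) (2 * k + 1) (T_biggap k)) /
        real (border_rank (2 * k + 1) (2 * k + 1) (2 * k + 1) (T_biggap k)))
     \<longlonglongrightarrow> 5 / 2"
proof -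
  have bounds: "2 * k + 1 \<le> border_rank (2 * k + 1) (2 * k + 1) (2 * k + 1) (T_biggap k)"
    "border_rank (2 * k + 1) (2 * k + 1) (2 * k + 1) (T_biggap k) \<le> 2 * k + 2"
    "tensor_rank (2 * k + 1) (2 * k + 1) (2 * k + 1) (T_biggap k) = 5 * k" if "k \<ge> 1" for k
    using border_rank_T_biggap_lower[OF that] border_rank_T_biggap_upper[OF that]
      tensor_rank_le[OF rank_T_biggap_upper[OF that]]
      rank_T_biggap_lower[OF that rank_at_most_tensor_rank] by (auto intro: antisym)
  let ?ratio = "\<lambda>k. real (tensor_rank (2 * k + 1) (2 * k + 1) (2 * k + 1) (T_biggap k)) /
        real (border_rank (2 * k + 1) (2 * k + 1) (2 * k + 1) (T_biggap k))"
  have "?ratio \<longlonglongrightarrow> 5 / 2"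
  proof (rule tendsto_sandwich)
    have "(\<lambda>k. 5 / 2 * (real k / real (Suc k))) \<longlonglongrightarrow> 5 / 2 * 1"
      by (intro tendsto_intros LIMSEQ_n_over_Suc_n)
    then show "(\<lambda>k. 5 / 2 * (real k / real (Suc k))) \<longlonglongrightarrow> 5 / 2" by simp
    \<comment> \<open>The ratio lies between \<open>5 * k / (2 * k + 2)\<close> and
      \<open>5 * k / (2 * k + 1)\<close>, and the latter is below 5/2.\<close>
    have ratio: "5 / 2 * (real k / real (Suc k)) \<le> ?ratio k \<and> ?ratio k \<le> 5 / 2" if "k \<ge> 1" for k
    proof -
      define r where "r = real (border_rank (2 * k + 1) (2 * k + 1) (2 * k + 1) (T_biggap k))"
      have r: "2 * real k + 1 \<le> r" "r \<le> 2 * real k + 2"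
        using bounds(1,2)[OF that] unfolding r_def by linarith+
      have "5 * real k / (2 * real k + 2) \<le> 5 * real k / r"
        using r by (intro divide_left_mono mult_pos_pos) auto
      moreover have "5 / 2 * (real k / real (Suc k)) = 5 * real k / (2 * real k + 2)"
        by (simp add: field_simps)
      moreover have "5 * real k / r \<le> 5 / 2"
        using r by (simp add: divide_simps)
      ultimately show ?thesis
        unfolding bounds(3)[OF that] r_def[symmetric] by (simp only: of_nat_mult of_nat_numeral simp_thms)
    qed
    show "\<forall>\<^sub>F k in sequentially. 5 / 2 * (real k / real (Suc k)) \<le> ?ratio k"
      "\<forall>\<^sub>F k in sequentially. ?ratio k \<le> 5 / 2"
      using ratio by (auto intro!: eventually_sequentiallyI[of 1])
  qed simp
  then show ?thesis
    using bounds by auto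
qed

end
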